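(* In general, two strictly relativistic trajectories cannot be images of one common trajectory of a mechanical system. Precisely: (i) Let $\mathcal{S}'=(M,T_2',\alpha')$ and $\mathcal{S}''=(M,T_2'',\alpha'')$ be two relativistic mechanical systems on the same smooth manifold $M$, let $A,B\in M$, and let $\Gamma'$ and $\Gamma''$ be strictly relativistic trajectories of $\mathcal{S}'$ and $\mathcal{S}''$ respectively, each joining the initial point $A$ to the final point $B$. If the proper time elapsed in $\Gamma'$ (with respect to $T_2'$) is different from the proper time elapsed in $\Gamma''$ (with respect to $T_2''$), then there do not exist a mechanical system $\widehat{\mathcal{S}}=(\widehat M,\widehat T_2,\widehat\alpha)$ (relativistic or not), smooth maps $\varphi'\colon\widehat M\to M$ and $\varphi''\colon\widehat M\to M$, and a trajectory $\widehat\Gamma$ of $\widehat{\mathcal{S}}$ such that $\varphi'_*(\widehat\Gamma)=\Gamma'$ and $\varphi''_*(\widehat\Gamma)=\Gamma''$. (ii) There exist a smooth manifold $M$, relativistic mechanical systems $\mathcal{S}',\mathcal{S}''$ on $M$, points $A,B\in M$ and strictly relativistic trajectories $\Gamma',\Gamma''$ of $\mathcal{S}',\mathcal{S}''$, each joining $A$ to $B$, whose elapsed proper times are different. For such a pair no $(\widehat{\mathcal{S}},\varphi',\varphi'',\widehat\Gamma)$ as in (i) exists.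
   Context: Let $M$ be a smooth manifold with tangent bundle $\pi\colon TM\to M$; local coordinates $x^j$ on $M$ induce coordinates $(x^j,\dot x^j)$ on $TM$. A 1-form on $TM$ is horizontal if it annihilates all vectors tangent to the fibres of $\pi$ (locally $\alpha=b_j(x,\dot x)\,dx^j$). For a horizontal 1-form $\alpha$, $\dot\alpha$ is the function on $TM$ given by $\dot\alpha(v)=\langle\alpha,v\rangle$, i.e. $\dot\alpha=b_j\dot x^j$. A second order differential equation on $M$ is a vector field $D$ on $TM$ with $\pi_*(D_{v})=v$ for all $v\in TM$, i.e. locally $D=\dot x^j\,\partial/\partial x^j+f^j(x,\dot x)\,\partial/\partial\dot x^j$. A mechanical system is a triple $(M,T_2,\alpha)$ where $M$ is a smooth manifold, $T_2=g_{ij}\,dx^i\,dx^j$ is a pseudo-Riemannian metric (non-degenerate, arbitrary signature) and $\alpha$ is a horizontal 1-form on $TM$. Put $\theta=g_{ij}\dot x^i\,dx^j$ (Liouville form transported to $TM$ by the metric), $\omega_2=d\theta$, and $T=\tfrac12\dot\theta=\tfrac12 g_{ij}\dot x^i\dot x^j$ (kinetic energy). The equation of motion of the system is the unique second order differential equation $D$ such that $D\lrcorner\,\omega_2+dT+\alpha=0$; in coordinates, $\ddot x^j+\Gamma^j_{k\ell}\dot x^k\dot x^\ell+g^{ij}\alpha_i=0$, where $\Gamma^j_{k\ell}$ are the Christoffel symbols of $T_2$ and $\alpha=\alpha_i\,dx^i$. The trajectories of the system are the solution (integral) curves $\Gamma\colon[a,b]\to TM$ of $D$; each is the lift $(x(t),dx/dt)$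 of a parameterized curve in $M$. Trajectories are considered up to translation of the parameter. $\Gamma$ joins $A$ to $B$ if $\pi(\Gamma(a))=A$ and $\pi(\Gamma(b))=B$. The mechanical system is relativistic if $DT=0$. The length element is the 1-form $\theta/\sqrt{|\dot\theta|}$ on the open set of $TM$ where $\dot\theta\neq0$; the proper time elapsed in a trajectory $\Gamma$ is its length $\int_a^b\sqrt{\left|g_{ij}\frac{dx^i}{dt}\frac{dx^j}{dt}\right|}\,dt$. A trajectory $\Gamma$ of a relativistic mechanical system is strictly relativistic if it is parameterized by proper time, i.e. $|\dot\theta|=1$ along $\Gamma$. For a smooth map $\varphi\colon\widehat M\to M$, $\varphi_*\colon T\widehat M\to TM$ is the tangent map, and $\varphi_*(\widehat\Gamma)$ denotes the parameterized curve $\varphi_*\circ\widehat\Gamma$. *)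

theory Defs
  imports "HOL-Analysis.Analysis"
begin

section \<open>Smooth functions on open sets of a normed space\<close>

primrec C_order_on :: "nat \<Rightarrow> 'e::real_normed_vector set \<Rightarrow> ('e \<Rightarrow> 'f::real_normed_vector) \<Rightarrow> bool" where
  "C_order_on 0 S f \<longleftrightarrow> continuous_on S f"
| "C_order_on (Suc k) S f \<longleftrightarrow>
     (\<forall>x\<in>S. f differentiable (at x)) \<and>
     (\<forall>v. C_order_on k S (\<lambda>x. frechet_derivative f (at x) v))"

text \<open>Directional derivatives of all orders exist and are continuous.  On an open subset of a
  finite-dimensional space, the only case used below, this is the usual notion of smoothness.\<close>

definition smooth_on :: "'e::real_normed_vector set \<Rightarrow> ('e \<Rightarrow> 'f::real_normed_vector) \<Rightarrow> bool" where
  "smooth_on S f \<longleftrightarrow> (\<forall>k. C_order_on k S f)"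


section \<open>Smooth manifolds\<close>

text \<open>A manifold is given by a (not necessarily maximal) atlas; a chart is a pair of a domain and
  a coordinate map, the latter being relevant only on the domain.  The model space is a
  finite-dimensional normed space rather than a type of class \<^class>\<open>euclidean_space\<close>, because that
  class excludes dimension zero.\<close>

type_synonym ('a, 'e) chart = "'a set \<times> ('a \<Rightarrow> 'e)"
type_synonym ('a, 'e) atlas = "('a, 'e) chart set"

abbreviation dom_chart :: "('a, 'e) chart \<Rightarrow> 'a set" where "dom_chart \<equiv> fst"
abbreviation coord :: "('a, 'e) chart \<Rightarrow> 'a \<Rightarrow> 'e" where "coord \<equiv> snd"

definition coord_inv :: "('a, 'e) chart \<Rightarrow> 'e \<Rightarrow> 'a" where
  "coord_inv c = inv_into (dom_chart c) (coord c)"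

definition coord_range :: "('a, 'e) chart \<Rightarrow> 'e set" where
  "coord_range c = coord c ` dom_chart c"

definition points :: "('a, 'e) atlas \<Rightarrow> 'a set" where
  "points M = (\<Union>c\<in>M. dom_chart c)"

definition charts_at :: "('a, 'e) atlas \<Rightarrow> 'a \<Rightarrow> ('a, 'e) chart set" where
  "charts_at M p = {c \<in> M. p \<in> dom_chart c}"

text \<open>Used in definitions whose result does not depend on the chart.\<close>

definition chart_at :: "('a, 'e) atlas \<Rightarrow> 'a \<Rightarrow> ('a, 'e) chart" where
  "chart_at M p = (SOME c. c \<in> charts_at M p)"

definition transition :: "('a, 'e) chart \<Rightarrow> ('a, 'f) chart \<Rightarrow> 'e \<Rightarrow> 'f" where
  "transition c d = (\<lambda>x. coord d (coord_inv c x))"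

definition manifold_topology :: "('a, 'e::real_normed_vector) atlas \<Rightarrow> 'a topology" where
  "manifold_topology M =
     topology (\<lambda>W. W \<subseteq> points M \<and> (\<forall>c\<in>M. open (coord c ` (W \<inter> dom_chart c))))"

definition smooth_manifold :: "('a, 'e::real_normed_vector) atlas \<Rightarrow> bool" where
  "smooth_manifold M \<longleftrightarrow>
     (\<exists>B :: 'e set. finite B \<and> span B = UNIV) \<and>
     (\<forall>c\<in>M. inj_on (coord c) (dom_chart c) \<and> open (coord_range c)) \<and>
     (\<forall>c\<in>M. \<forall>d\<in>M. open (coord c ` (dom_chart c \<inter> dom_chart d)) \<and>
        smooth_on (coord c ` (dom_chart c \<inter> dom_chart d)) (transition c d)) \<and>
     Hausdorff_space (manifold_topology M) \<and>
     second_countable (manifold_topology M)"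

definition smooth_map ::
    "('a, 'e::real_normed_vector) atlas \<Rightarrow> ('b, 'f::real_normed_vector) atlas \<Rightarrow> ('a \<Rightarrow> 'b) \<Rightarrow> bool" where
  "smooth_map M N \<phi> \<longleftrightarrow>
     \<phi> ` points M \<subseteq> points N \<and>
     (\<forall>c\<in>M. \<forall>d\<in>N. open (coord c ` (dom_chart c \<inter> \<phi> -` dom_chart d)) \<and>
        smooth_on (coord c ` (dom_chart c \<inter> \<phi> -` dom_chart d)) (\<lambda>x. coord d (\<phi> (coord_inv c x))))"


section \<open>Tangent vectors, tangent bundle, tangent maps\<close>

text \<open>A tangent vector at \<open>p\<close> is the family of its components in the charts at \<open>p\<close>, related by the
  derivatives of the transition maps; it is set to 0 at all other charts.\<close>

type_synonym ('a, 'e) tvec = "('a, 'e) chart \<Rightarrow> 'e"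

definition tangent_space :: "('a, 'e::real_normed_vector) atlas \<Rightarrow> 'a \<Rightarrow> ('a, 'e) tvec set" where
  "tangent_space M p =
     {v. (\<forall>c\<in>charts_at M p. \<forall>d\<in>charts_at M p.
            v d = frechet_derivative (transition c d) (at (coord c p)) (v c)) \<and>
         (\<forall>c. c \<notin> charts_at M p \<longrightarrow> v c = 0)}"

text \<open>The tangent vector at \<open>p\<close> with component \<open>x\<close> in the chart \<open>c\<close>.\<close>

definition tvec_of :: "('a, 'e::real_normed_vector) atlas \<Rightarrow> ('a, 'e) chart \<Rightarrow> 'a \<Rightarrow> 'e \<Rightarrow> ('a, 'e) tvec" where
  "tvec_of M c p x =
     (\<lambda>d. if d \<in> charts_at M p then frechet_derivative (transition c d) (at (coord c p)) x else 0)"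

definition bundle_chart ::
    "('a, 'e::real_normed_vector) atlas \<Rightarrow> ('a, 'e) chart \<Rightarrow> ('a \<times> ('a, 'e) tvec, 'e \<times> 'e) chart" where
  "bundle_chart M c = (Sigma (dom_chart c) (tangent_space M), \<lambda>(p, v). (coord c p, v c))"

definition tangent_bundle ::
    "('a, 'e::real_normed_vector) atlas \<Rightarrow> ('a \<times> ('a, 'e) tvec, 'e \<times> 'e) atlas" where
  "tangent_bundle M = bundle_chart M ` M"

definition tangent_map ::
    "('a, 'e::real_normed_vector) atlas \<Rightarrow> ('b, 'f::real_normed_vector) atlas \<Rightarrow> ('a \<Rightarrow> 'b) \<Rightarrow>
     'a \<times> ('a, 'e) tvec \<Rightarrow> 'b \<times> ('b, 'f) tvec" where
  "tangent_map M N \<phi> = (\<lambda>(p, v).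
     let c = chart_at M p in
     (\<phi> p, \<lambda>d. if d \<in> charts_at N (\<phi> p)
               then frechet_derivative (\<lambda>x. coord d (\<phi> (coord_inv c x))) (at (coord c p)) (v c)
               else 0))"

text \<open>The projection \<open>\<pi>\<close> of the tangent bundle is \<^const>\<open>fst\<close>.\<close>

definition tangent_proj ::
    "('a, 'e::real_normed_vector) atlas \<Rightarrow>
     ('a \<times> ('a, 'e) tvec) \<times> ('a \<times> ('a, 'e) tvec, 'e \<times> 'e) tvec \<Rightarrow> 'a \<times> ('a, 'e) tvec" where
  "tangent_proj M = tangent_map (tangent_bundle M) M fst"


section \<open>Functions, vector fields and forms\<close>

definition vector_field ::
    "('a, 'e::real_normed_vector) atlas \<Rightarrow> ('a \<Rightarrow> ('a, 'e) tvec) \<Rightarrow> bool" where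
  "vector_field M X \<longleftrightarrow>
     (\<forall>p\<in>points M. X p \<in> tangent_space M p) \<and>
     (\<forall>c\<in>M. smooth_on (coord_range c) (\<lambda>y. X (coord_inv c y) c))"

definition differential ::
    "('a, 'e::real_normed_vector) atlas \<Rightarrow> ('a \<Rightarrow> real) \<Rightarrow> 'a \<Rightarrow> ('a, 'e) tvec \<Rightarrow> real" where
  "differential M F p X =
     (let c = chart_at M p
      in frechet_derivative (\<lambda>y. F (coord_inv c y)) (at (coord c p)) (X c))"

definition form_coeff ::
    "('a, 'e::real_normed_vector) atlas \<Rightarrow> ('a \<Rightarrow> ('a, 'e) tvec \<Rightarrow> real) \<Rightarrow> ('a, 'e) chart \<Rightarrow>
     'e \<Rightarrow> 'e \<Rightarrow> real" where
  "form_coeff M \<omega> c y x = \<omega> (coord_inv c y) (tvec_of M c (coord_inv c y) x)"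

definition one_form ::
    "('a, 'e::real_normed_vector) atlas \<Rightarrow> ('a \<Rightarrow> ('a, 'e) tvec \<Rightarrow> real) \<Rightarrow> bool" where
  "one_form M \<omega> \<longleftrightarrow>
     (\<forall>c\<in>M. (\<forall>y\<in>coord_range c. linear (form_coeff M \<omega> c y)) \<and>
            (\<forall>x. smooth_on (coord_range c) (\<lambda>y. form_coeff M \<omega> c y x)))"

text \<open>Normalised by \<open>d\<omega>(X, Y) = X \<omega>(Y) - Y \<omega>(X)\<close> for \<open>X\<close>, \<open>Y\<close> with constant components in a chart.\<close>

definition ext_deriv ::
    "('a, 'e::real_normed_vector) atlas \<Rightarrow> ('a \<Rightarrow> ('a, 'e) tvec \<Rightarrow> real) \<Rightarrow>
     'a \<Rightarrow> ('a, 'e) tvec \<Rightarrow> ('a, 'e) tvec \<Rightarrow> real" where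
  "ext_deriv M \<omega> p X Y =
     (let c = chart_at M p
      in frechet_derivative (\<lambda>y. form_coeff M \<omega> c y (Y c)) (at (coord c p)) (X c)
       - frechet_derivative (\<lambda>y. form_coeff M \<omega> c y (X c)) (at (coord c p)) (Y c))"

definition pseudo_riemannian ::
    "('a, 'e::real_normed_vector) atlas \<Rightarrow> ('a \<Rightarrow> ('a, 'e) tvec \<Rightarrow> ('a, 'e) tvec \<Rightarrow> real) \<Rightarrow> bool" where
  "pseudo_riemannian M g \<longleftrightarrow>
     (\<forall>c\<in>M. \<forall>p\<in>dom_chart c. bilinear (\<lambda>x x'. g p (tvec_of M c p x) (tvec_of M c p x'))) \<and>
     (\<forall>c\<in>M. \<forall>x x'. smooth_on (coord_range c)
        (\<lambda>y. g (coord_inv c y) (tvec_of M c (coord_inv c y) x) (tvec_of M c (coord_inv c y) x'))) \<and>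
     (\<forall>p\<in>points M. \<forall>v\<in>tangent_space M p. \<forall>w\<in>tangent_space M p. g p v w = g p w v) \<and>
     (\<forall>p\<in>points M. \<forall>v\<in>tangent_space M p.
        (\<forall>w\<in>tangent_space M p. g p v w = 0) \<longrightarrow> v = (\<lambda>_. 0))"

definition horizontal ::
    "('a, 'e::real_normed_vector) atlas \<Rightarrow>
     ('a \<times> ('a, 'e) tvec \<Rightarrow> ('a \<times> ('a, 'e) tvec, 'e \<times> 'e) tvec \<Rightarrow> real) \<Rightarrow> bool" where
  "horizontal M \<alpha> \<longleftrightarrow>
     (\<forall>u\<in>points (tangent_bundle M). \<forall>X\<in>tangent_space (tangent_bundle M) u.
        snd (tangent_proj M (u, X)) = (\<lambda>_. 0) \<longrightarrow> \<alpha> u X = 0)"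

text \<open>For a horizontal form \<open>\<alpha>\<close>, the pairing of \<open>\<alpha>\<close> at \<open>u\<close> with the tangent vector \<open>u\<close> itself is its
  value on any vector \<open>X\<close> at \<open>u\<close> that projects to \<open>u\<close>.\<close>

definition dot_form ::
    "('a, 'e::real_normed_vector) atlas \<Rightarrow>
     ('a \<times> ('a, 'e) tvec \<Rightarrow> ('a \<times> ('a, 'e) tvec, 'e \<times> 'e) tvec \<Rightarrow> real) \<Rightarrow>
     'a \<times> ('a, 'e) tvec \<Rightarrow> real" where
  "dot_form M \<alpha> u =
     \<alpha> u (SOME X. X \<in> tangent_space (tangent_bundle M) u \<and> tangent_proj M (u, X) = u)"


section \<open>Mechanical systems\<close>

record ('a, 'e) mech_system =
  config :: "('a, 'e) atlas"
  gmetric :: "'a \<Rightarrow> ('a, 'e) tvec \<Rightarrow> ('a, 'e) tvec \<Rightarrow> real"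
  force :: "'a \<times> ('a, 'e) tvec \<Rightarrow> ('a \<times> ('a, 'e) tvec, 'e \<times> 'e) tvec \<Rightarrow> real"

definition mechanical_system :: "('a, 'e::real_normed_vector) mech_system \<Rightarrow> bool" where
  "mechanical_system S \<longleftrightarrow>
     smooth_manifold (config S) \<and>
     pseudo_riemannian (config S) (gmetric S) \<and>
     one_form (tangent_bundle (config S)) (force S) \<and>
     horizontal (config S) (force S)"

definition liouville ::
    "('a, 'e::real_normed_vector) mech_system \<Rightarrow>
     'a \<times> ('a, 'e) tvec \<Rightarrow> ('a \<times> ('a, 'e) tvec, 'e \<times> 'e) tvec \<Rightarrow> real" where
  "liouville S u X = gmetric S (fst u) (snd u) (snd (tangent_proj (config S) (u, X)))"

definition kinetic_energy ::
    "('a, 'e::real_normed_vector) mech_system \<Rightarrow> 'a \<times> ('a, 'e) tvec \<Rightarrow> real" where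
  "kinetic_energy S u = dot_form (config S) (liouville S) u / 2"

definition second_order_ode ::
    "('a, 'e::real_normed_vector) atlas \<Rightarrow>
     ('a \<times> ('a, 'e) tvec \<Rightarrow> ('a \<times> ('a, 'e) tvec, 'e \<times> 'e) tvec) \<Rightarrow> bool" where
  "second_order_ode M D \<longleftrightarrow>
     vector_field (tangent_bundle M) D \<and>
     (\<forall>u\<in>points (tangent_bundle M). tangent_proj M (u, D u) = u)"

text \<open>\<open>D\<close> is determined by the system on the points of the tangent bundle, but not off them; hence a
  predicate rather than a function of \<open>S\<close>.\<close>

definition equation_of_motion ::
    "('a, 'e::real_normed_vector) mech_system \<Rightarrow>
     ('a \<times> ('a, 'e) tvec \<Rightarrow> ('a \<times> ('a, 'e) tvec, 'e \<times> 'e) tvec) \<Rightarrow> bool" where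
  "equation_of_motion S D \<longleftrightarrow>
     second_order_ode (config S) D \<and>
     (\<forall>u\<in>points (tangent_bundle (config S)). \<forall>Y\<in>tangent_space (tangent_bundle (config S)) u.
        ext_deriv (tangent_bundle (config S)) (liouville S) u (D u) Y
        + differential (tangent_bundle (config S)) (kinetic_energy S) u Y
        + force S u Y = 0)"

definition relativistic :: "('a, 'e::real_normed_vector) mech_system \<Rightarrow> bool" where
  "relativistic S \<longleftrightarrow>
     (\<exists>D. equation_of_motion S D \<and>
        (\<forall>u\<in>points (tangent_bundle (config S)).
           differential (tangent_bundle (config S)) (kinetic_energy S) u (D u) = 0))"


section \<open>Trajectories\<close>

record 'p curve =
  t_start :: real
  t_end :: real
  at_time :: "real \<Rightarrow> 'p"

definition integral_curve ::
    "('a, 'e::real_normed_vector) atlas \<Rightarrow> ('a \<Rightarrow> ('a, 'e) tvec) \<Rightarrow> 'a curve \<Rightarrow> bool" where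
  "integral_curve M X \<Gamma> \<longleftrightarrow>
     t_start \<Gamma> < t_end \<Gamma> \<and>
     continuous_map (top_of_set {t_start \<Gamma>..t_end \<Gamma>}) (manifold_topology M) (at_time \<Gamma>) \<and>
     (\<forall>t\<in>{t_start \<Gamma>..t_end \<Gamma>}. \<forall>c\<in>charts_at M (at_time \<Gamma> t).
        ((\<lambda>s. coord c (at_time \<Gamma> s)) has_vector_derivative X (at_time \<Gamma> t) c)
          (at t within {t_start \<Gamma>..t_end \<Gamma>}))"

definition trajectory ::
    "('a, 'e::real_normed_vector) mech_system \<Rightarrow> ('a \<times> ('a, 'e) tvec) curve \<Rightarrow> bool" where
  "trajectory S \<Gamma> \<longleftrightarrow>
     (\<exists>D. equation_of_motion S D \<and> integral_curve (tangent_bundle (config S)) D \<Gamma>)"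

definition strictly_relativistic_trajectory ::
    "('a, 'e::real_normed_vector) mech_system \<Rightarrow> ('a \<times> ('a, 'e) tvec) curve \<Rightarrow> bool" where
  "strictly_relativistic_trajectory S \<Gamma> \<longleftrightarrow>
     trajectory S \<Gamma> \<and>
     (\<forall>t\<in>{t_start \<Gamma>..t_end \<Gamma>}. \<bar>dot_form (config S) (liouville S) (at_time \<Gamma> t)\<bar> = 1)"

definition joins :: "('a \<times> ('a, 'e) tvec) curve \<Rightarrow> 'a \<Rightarrow> 'a \<Rightarrow> bool" where
  "joins \<Gamma> A B \<longleftrightarrow> fst (at_time \<Gamma> (t_start \<Gamma>)) = A \<and> fst (at_time \<Gamma> (t_end \<Gamma>)) = B"

text \<open>A trajectory is the lift \<open>(x, dx/dt)\<close> of its projection, so \<open>dx/dt\<close> is the second component.\<close>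

definition proper_time ::
    "('a, 'e::real_normed_vector) mech_system \<Rightarrow> ('a \<times> ('a, 'e) tvec) curve \<Rightarrow> real" where
  "proper_time S \<Gamma> =
     integral {t_start \<Gamma>..t_end \<Gamma>}
       (\<lambda>t. sqrt \<bar>gmetric S (fst (at_time \<Gamma> t)) (snd (at_time \<Gamma> t)) (snd (at_time \<Gamma> t))\<bar>)"

definition image_curve :: "('p \<Rightarrow> 'q) \<Rightarrow> 'p curve \<Rightarrow> 'q curve" where
  "image_curve F \<Gamma> =
     \<lparr>t_start = t_start \<Gamma>, t_end = t_end \<Gamma>, at_time = (\<lambda>t. F (at_time \<Gamma> t))\<rparr>"

definition same_curve :: "'p curve \<Rightarrow> 'p curve \<Rightarrow> bool" where
  "same_curve \<Gamma> \<Delta> \<longleftrightarrow>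
     (\<exists>s. t_start \<Delta> = t_start \<Gamma> + s \<and> t_end \<Delta> = t_end \<Gamma> + s \<and>
        (\<forall>t\<in>{t_start \<Gamma>..t_end \<Gamma>}. at_time \<Delta> (t + s) = at_time \<Gamma> t))"

definition strictly_relativistic_pair ::
    "('a, 'e::real_normed_vector) atlas \<Rightarrow> ('a, 'e) mech_system \<Rightarrow> ('a, 'e) mech_system \<Rightarrow> 'a \<Rightarrow> 'a \<Rightarrow>
     ('a \<times> ('a, 'e) tvec) curve \<Rightarrow> ('a \<times> ('a, 'e) tvec) curve \<Rightarrow> bool" where
  "strictly_relativistic_pair M S' S'' A B \<Gamma>' \<Gamma>'' \<longleftrightarrow>
     smooth_manifold M \<and> config S' = M \<and> config S'' = M \<and>
     mechanical_system S' \<and> relativistic S' \<and>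
     mechanical_system S'' \<and> relativistic S'' \<and>
     A \<in> points M \<and> B \<in> points M \<and>
     strictly_relativistic_trajectory S' \<Gamma>' \<and> joins \<Gamma>' A B \<and>
     strictly_relativistic_trajectory S'' \<Gamma>'' \<and> joins \<Gamma>'' A B"

definition common_preimage ::
    "('a, 'e::real_normed_vector) atlas \<Rightarrow>
     ('a \<times> ('a, 'e) tvec) curve \<Rightarrow> ('a \<times> ('a, 'e) tvec) curve \<Rightarrow>
     ('b, 'f::real_normed_vector) mech_system \<Rightarrow> ('b \<Rightarrow> 'a) \<Rightarrow> ('b \<Rightarrow> 'a) \<Rightarrow>
     ('b \<times> ('b, 'f) tvec) curve \<Rightarrow> bool" where
  "common_preimage M \<Gamma>' \<Gamma>'' S \<phi>' \<phi>'' \<Gamma> \<longleftrightarrow>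
     mechanical_system S \<and>
     smooth_map (config S) M \<phi>' \<and> smooth_map (config S) M \<phi>'' \<and>
     trajectory S \<Gamma> \<and>
     same_curve (image_curve (tangent_map (config S) M \<phi>') \<Gamma>) \<Gamma>' \<and>
     same_curve (image_curve (tangent_map (config S) M \<phi>'') \<Gamma>) \<Gamma>''"

end

theory Submission
  imports Defs
begin

text \<open>Along a strictly relativistic trajectory the integrand of the proper time is 1, so the elapsed
  proper time is the length of the parameter interval.  Composing a curve with a tangent map keeps the
  parameter interval, hence two images of one trajectory have equal proper times.  For (ii), the
  free motions on the line from 0 to 1 with velocities 1 and 1/2 have unit speed for the metrics
  \<open>dx\<^sup>2\<close> and \<open>4 dx\<^sup>2\<close> respectively, and take times 1 and 2.\<close>

section \<open>Proper time and duration\<close>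

text \<open>\<open>topology\<close> has the intended open sets only once its predicate is known to
  be a topology. Injectivity of the charts makes images commute with intersections; unions commute
  with images anyway.\<close>

lemma openin_manifold_topology:
  assumes inj: "\<And>c. c \<in> M \<Longrightarrow> inj_on (coord c) (dom_chart c)"
  shows "openin (manifold_topology M) W \<longleftrightarrow>
           W \<subseteq> points M \<and> (\<forall>c\<in>M. open (coord c ` (W \<inter> dom_chart c)))"
proof -
  let ?L = "\<lambda>W. W \<subseteq> points M \<and> (\<forall>c\<in>M. open (coord c ` (W \<inter> dom_chart c)))"
  have "?L (U \<inter> V)" if "?L U" "?L V" for U V
  proof (intro conjI ballI)
    show "U \<inter> V \<subseteq> points M" using that by blast
    fix c assume c: "c \<in> M"
    have "coord c ` ((U \<inter> V) \<inter> dom_chart c)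
        = coord c ` ((U \<inter> dom_chart c) \<inter> (V \<inter> dom_chart c))"
      by (rule arg_cong[where f = "(`) (coord c)"]) blast
    also have "\<dots> = coord c ` (U \<inter> dom_chart c) \<inter> coord c ` (V \<inter> dom_chart c)"
      by (rule inj_on_image_Int[OF inj[OF c]]) auto
    finally show "open (coord c ` ((U \<inter> V) \<inter> dom_chart c))"
      using that c by (simp add: open_Int)
  qed
  moreover have "?L (\<Union>K)" if "\<forall>U\<in>K. ?L U" for K
  proof (intro conjI ballI)
    show "\<Union>K \<subseteq> points M" using that by blast
    fix c assume c: "c \<in> M"
    have "coord c ` (\<Union>K \<inter> dom_chart c) = (\<Union>U\<in>K. coord c ` (U \<inter> dom_chart c))" by blast
    then show "open (coord c ` (\<Union>K \<inter> dom_chart c))"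
      using that c by auto
  qed
  ultimately have "istopology ?L"
    unfolding istopology_def by blast
  then show ?thesis
    by (simp add: manifold_topology_def topology_inverse')
qed

lemma topspace_manifold_topology_subset:
  assumes "\<And>c. c \<in> M \<Longrightarrow> inj_on (coord c) (dom_chart c)"
  shows "topspace (manifold_topology M) \<subseteq> points M"
  using openin_manifold_topology[OF assms] openin_topspace by blast

text \<open>The base point is recovered from \<open>coord c\<close>. One component then fixes the
  whole tangent vector: the components in other charts at the point come from the derivatives of the
  transition maps.\<close>

lemma inj_on_bundle_chart:
  assumes "c \<in> M" "inj_on (coord c) (dom_chart c)"
  shows "inj_on (coord (bundle_chart M c)) (dom_chart (bundle_chart M c))"
proof (rule inj_onI, clarsimp simp: bundle_chart_def)
  fix p v q w
  assume *: "p \<in> dom_chart c" "v \<in> tangent_space M p" "q \<in> dom_chart c" "w \<in> tangent_space M q"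
    and "coord c p = coord c q" and eq: "v c = w c"
  then have pq: "p = q" using assms(2) by (simp add: inj_on_eq_iff)
  have c: "c \<in> charts_at M q" using * assms(1) by (simp add: charts_at_def)
  have "v d = w d" for d
  proof (cases "d \<in> charts_at M q")
    case True
    have "u d = frechet_derivative (transition c d) (at (coord c q)) (u c)"
      if "u \<in> tangent_space M q" for u
      using that c True unfolding tangent_space_def by blast
    then show ?thesis using * eq unfolding pq by metis
  next
    \<comment> \<open>Away from the charts at the base point, both vectors take the default value
      0.\<close>
    case False
    then have "u d = 0" if "u \<in> tangent_space M q" for u
      using that unfolding tangent_space_def by blast
    then show ?thesis using * unfolding pq by metis
  qed
  then show "p = q \<and> v = w" using pq by auto
qed

text \<open>The derivative condition of \<open>integral_curve\<close> says nothing where no chart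
  applies. Membership comes from continuity, which puts the curve in the
  \<open>topspace\<close>.\<close>

lemma integral_curve_in_points:
  assumes "smooth_manifold M" "integral_curve (tangent_bundle M) D \<Gamma>" "t \<in> {t_start \<Gamma>..t_end \<Gamma>}"
  shows "at_time \<Gamma> t \<in> points (tangent_bundle M)"
proof -
  have "at_time \<Gamma> t \<in> topspace (manifold_topology (tangent_bundle M))"
    using assms(2,3) unfolding integral_curve_def continuous_map_def by auto
  moreover have "inj_on (coord c) (dom_chart c)" if "c \<in> tangent_bundle M" for c
    using that assms(1) unfolding tangent_bundle_def smooth_manifold_def
    by (auto intro: inj_on_bundle_chart)
  ultimately show ?thesis
    using topspace_manifold_topology_subset by blast
qed

text \<open>The Liouville form sees \<open>X\<close> only through its projection, so the choice made
  in \<open>dot_form\<close> is harmless once a suitable \<open>X\<close> exists. A second order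
  equation supplies one, namely \<open>D u\<close>.\<close>

lemma dot_form_liouville:
  assumes "second_order_ode (config S) D" "u \<in> points (tangent_bundle (config S))"
  shows "dot_form (config S) (liouville S) u = gmetric S (fst u) (snd u) (snd u)"
proof -
  let ?P = "\<lambda>X. X \<in> tangent_space (tangent_bundle (config S)) u \<and> tangent_proj (config S) (u, X) = u"
  have "?P (D u)"
    using assms by (simp add: second_order_ode_def vector_field_def)
  then have "?P (SOME X. ?P X)" by (rule someI[of ?P])
  then show ?thesis
    by (simp add: dot_form_def liouville_def)
qed

text \<open>Unit speed is stated through \<open>dot_form\<close>, proper time through the metric.
  The field \<open>D\<close> of the trajectory licenses the passage between them, after which the
  integrand is 1.\<close>

lemma proper_time_strictly_relativistic:
  assumes "smooth_manifold (config S)" "strictly_relativistic_trajectory S \<Gamma>"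
  shows "proper_time S \<Gamma> = t_end \<Gamma> - t_start \<Gamma>"
proof -
  obtain D where D: "equation_of_motion S D" "integral_curve (tangent_bundle (config S)) D \<Gamma>"
    using assms(2) by (auto simp: strictly_relativistic_trajectory_def trajectory_def)
  have "sqrt \<bar>gmetric S (fst (at_time \<Gamma> t)) (snd (at_time \<Gamma> t)) (snd (at_time \<Gamma> t))\<bar> = 1"
    if t: "t \<in> {t_start \<Gamma>..t_end \<Gamma>}" for t
  proof -
    have "dot_form (config S) (liouville S) (at_time \<Gamma> t) =
        gmetric S (fst (at_time \<Gamma> t)) (snd (at_time \<Gamma> t)) (snd (at_time \<Gamma> t))"
      using D(1) integral_curve_in_points[OF assms(1) D(2) t]
      unfolding equation_of_motion_def by (intro dot_form_liouville) blast+
    then show ?thesis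
      using assms(2) t unfolding strictly_relativistic_trajectory_def by (metis real_sqrt_one)
  qed
  then have "proper_time S \<Gamma> = integral {t_start \<Gamma>..t_end \<Gamma>} (\<lambda>_. 1)"
    unfolding proper_time_def by (intro integral_cong)
  \<comment> \<open>The order of the endpoints matters: over an empty interval the integral would be
    0 instead of the difference.\<close>
  moreover have "t_start \<Gamma> < t_end \<Gamma>" using D(2) by (simp add: integral_curve_def)
  ultimately show ?thesis by simp
qed

lemma common_preimage_imp_proper_time_eq:
  assumes "strictly_relativistic_pair M S' S'' A B \<Gamma>' \<Gamma>''"
    and "common_preimage M \<Gamma>' \<Gamma>'' S \<phi>' \<phi>'' \<Gamma>"
  shows "proper_time S' \<Gamma>' = proper_time S'' \<Gamma>''"
proof -
  \<comment> \<open>Both sides equal the duration of \<open>\<Gamma>\<close>, since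
    \<open>same_curve\<close> shifts both endpoints by the same amount.\<close>
  have "t_end \<Gamma>' - t_start \<Gamma>' = t_end \<Gamma>'' - t_start \<Gamma>''"
    using assms(2) by (auto simp: common_preimage_def same_curve_def image_curve_def)
  then show ?thesis
    using assms(1) proper_time_strictly_relativistic[of S' \<Gamma>']
      proper_time_strictly_relativistic[of S'' \<Gamma>'']
    by (auto simp: strictly_relativistic_pair_def)
qed


section \<open>Atlases with one global chart\<close>

lemma smooth_on_const: "smooth_on S (\<lambda>_. a)"
proof -
  have "C_order_on k S (\<lambda>_. a)" for k
    \<comment> \<open>The constant must vary in the induction, because the derivative is the
      constant 0.\<close>
    by (induction k arbitrary: a) auto
  then show ?thesis by (simp add: smooth_on_def)
qed

text \<open>The derivative is \<open>f\<close> at every point, so each directional derivative is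
  constant and the previous lemma settles all higher orders.\<close>

lemma smooth_on_bounded_linear:
  assumes "bounded_linear f"
  shows "smooth_on S f"
proof -
  have "frechet_derivative f (at x) = f" for x
    using frechet_derivative_at[OF bounded_linear_imp_has_derivative[OF assms]] by simp
  moreover have "f differentiable at x" for x
    using assms by (rule bounded_linear_imp_differentiable)
  moreover have "C_order_on k S (\<lambda>_. f v)" for k v
    using smooth_on_const[of S "f v"] by (simp add: smooth_on_def)
  ultimately have "C_order_on k S f" for k
    using linear_continuous_on[OF assms] by (cases k) auto
  then show ?thesis by (simp add: smooth_on_def)
qed

text \<open>Surjectivity onto the whole model space lets the inverse laws for
  \<open>coord_inv\<close> hold without conditions on \<open>y\<close>.\<close>

definition global_chart :: "('a, 'e) chart \<Rightarrow> bool" where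
  "global_chart c \<longleftrightarrow> bij_betw (coord c) (dom_chart c) UNIV"

context
  fixes c :: "('a, 'e::real_normed_vector) chart"
  assumes c: "global_chart c"
begin

lemma coord_range_global: "coord_range c = UNIV"
  using c by (simp add: global_chart_def coord_range_def bij_betw_def)

lemma coord_coord_inv: "coord c (coord_inv c y) = y"
  using c by (simp add: coord_inv_def f_inv_into_f global_chart_def bij_betw_def)

lemma coord_inv_in_dom: "coord_inv c y \<in> dom_chart c"
  using c by (simp add: coord_inv_def inv_into_into global_chart_def bij_betw_def)

lemma transition_global: "transition c c = (\<lambda>x. x)"
  by (simp add: transition_def coord_coord_inv)

lemma charts_at_global: "p \<in> dom_chart c \<Longrightarrow> charts_at {c} p = {c}"
  by (auto simp: charts_at_def)

lemma chart_at_global: "p \<in> dom_chart c \<Longrightarrow> chart_at {c} p = c"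
  by (simp add: chart_at_def charts_at_global)

lemma points_global: "points {c} = dom_chart c"
  by (simp add: points_def)

text \<open>The only transition map is the identity, so compatibility is automatic and only the
  default value at foreign charts remains.\<close>

lemma tangent_space_global: "p \<in> dom_chart c \<Longrightarrow> tangent_space {c} p = {v. \<forall>d. d \<noteq> c \<longrightarrow> v d = 0}"
  by (simp add: tangent_space_def charts_at_global transition_global frechet_derivative_ident)

lemma tvec_of_global: "p \<in> dom_chart c \<Longrightarrow> tvec_of {c} c p x = (\<lambda>d. if d = c then x else 0)"
  by (auto simp: tvec_of_def charts_at_global transition_global frechet_derivative_ident)

lemma form_coeff_global:
  "form_coeff {c} \<omega> c y x = \<omega> (coord_inv c y) (\<lambda>d. if d = c then x else 0)"
  by (simp add: form_coeff_def tvec_of_global coord_inv_in_dom)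

lemma differential_global:
  assumes "p \<in> dom_chart c"
    and "((\<lambda>y. F (coord_inv c y)) has_derivative F') (at (coord c p))"
  shows "differential {c} F p X = F' (X c)"
  using frechet_derivative_at[OF assms(2)]
  by (simp add: differential_def chart_at_global assms(1))

lemma openin_manifold_topology_global:
  "openin (manifold_topology {c}) W \<longleftrightarrow> W \<subseteq> dom_chart c \<and> open (coord c ` W)"
  using c
  by (subst openin_manifold_topology)
     (auto simp: global_chart_def bij_betw_def points_global Int_absorb2)

text \<open>Reduces continuity into the manifold to continuity of the coordinate expression, the
  form in which it is checked for the explicit motion.\<close>

lemma continuous_map_manifold_topology_global:
  assumes "continuous_on T (\<lambda>t. coord c (f t))" "f ` T \<subseteq> dom_chart c"
  shows "continuous_map (top_of_set T) (manifold_topology {c}) f"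
proof -
  have dom: "topspace (manifold_topology {c}) = dom_chart c"
  proof
    show "topspace (manifold_topology {c}) \<subseteq> dom_chart c"
      using openin_topspace openin_manifold_topology_global by blast
    show "dom_chart c \<subseteq> topspace (manifold_topology {c})"
      using c by (intro openin_subset)
        (simp add: openin_manifold_topology_global global_chart_def bij_betw_def)
  qed
  have "openin (top_of_set T) {t \<in> T. f t \<in> W}" if W: "W \<subseteq> dom_chart c" "open (coord c ` W)" for W
  proof -
    \<comment> \<open>Injectivity of the chart on its domain gives the inclusion from right to
      left.\<close>
    have "{t \<in> T. f t \<in> W} = T \<inter> (\<lambda>t. coord c (f t)) -` (coord c ` W)"
      using c W(1) assms(2) by (auto simp: global_chart_def bij_betw_def inj_on_def)
    then show ?thesis
      using assms(1) W(2) by (simp add: continuous_on_open_vimage continuous_openin_preimage_gen)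
  qed
  then show ?thesis
    using assms(2) by (auto simp: continuous_map_def dom openin_manifold_topology_global)
qed

end


section \<open>Free motion on the line\<close>

definition line_chart :: "(real, real) chart" where
  "line_chart = (UNIV, \<lambda>x. x)"

abbreviation line :: "(real, real) atlas" where
  "line \<equiv> {line_chart}"

definition line_vec :: "real \<Rightarrow> (real, real) tvec" where
  "line_vec x = (\<lambda>d. if d = line_chart then x else 0)"

abbreviation Tline_chart :: "(real \<times> (real, real) tvec, real \<times> real) chart" where
  "Tline_chart \<equiv> bundle_chart line line_chart"

text \<open>The metric is \<open>k dx^2\<close>, and no force acts.\<close>

definition line_system :: "real \<Rightarrow> (real, real) mech_system" where
  "line_system k =
     \<lparr>config = line, gmetric = \<lambda>p v w. k * v line_chart * w line_chart, force = \<lambda>u X. 0\<rparr>"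

text \<open>This is the field with zero acceleration; the value 0 at other charts is what
  \<open>tangent_space\<close> demands.\<close>

definition free_field ::
    "real \<times> (real, real) tvec \<Rightarrow> (real \<times> (real, real) tvec, real \<times> real) tvec" where
  "free_field u = (\<lambda>d. if d = Tline_chart then (snd u line_chart, 0) else 0)"

definition free_motion :: "real \<Rightarrow> real \<Rightarrow> (real \<times> (real, real) tvec) curve" where
  "free_motion v T = \<lparr>t_start = 0, t_end = T, at_time = \<lambda>t. (v * t, line_vec v)\<rparr>"

lemma line_system_simps [simp]:
  "config (line_system k) = line"
  "gmetric (line_system k) p v w = k * v line_chart * w line_chart"
  "force (line_system k) u X = 0"
  by (simp_all add: line_system_def)

lemma free_motion_simps [simp]:
  "t_start (free_motion v T) = 0"
  "t_end (free_motion v T) = T"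
  "at_time (free_motion v T) t = (v * t, line_vec v)"
  by (simp_all add: free_motion_def)

lemma line_chart_simps [simp]:
  "dom_chart line_chart = UNIV" "coord line_chart x = x" "coord_inv line_chart x = x"
  by (simp_all add: line_chart_def coord_inv_def)

lemma global_line_chart: "global_chart line_chart"
  by (simp add: global_chart_def line_chart_def bij_betw_def)

lemma tangent_space_line: "tangent_space line p = range line_vec"
  by (force simp: tangent_space_global[OF global_line_chart] line_vec_def image_iff)

lemma line_vec_line_chart [simp]: "line_vec x line_chart = x"
  by (simp add: line_vec_def)

lemma dom_Tline_chart: "dom_chart Tline_chart = UNIV \<times> range line_vec"
  by (auto simp: bundle_chart_def tangent_space_line)

lemma coord_Tline_chart: "coord Tline_chart u = (fst u, snd u line_chart)"
  by (simp add: bundle_chart_def case_prod_unfold)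

lemma global_Tline_chart: "global_chart Tline_chart"
  unfolding global_chart_def
  by (rule bij_betwI[where g = "\<lambda>y. (fst y, line_vec (snd y))"])
     (auto simp: dom_Tline_chart coord_Tline_chart)

lemma coord_inv_Tline_chart: "coord_inv Tline_chart y = (fst y, line_vec (snd y))"
  unfolding coord_inv_def
  by (rule inv_into_f_eq)
     (use global_Tline_chart in \<open>auto simp: global_chart_def bij_betw_def dom_Tline_chart coord_Tline_chart\<close>)

lemma tangent_bundle_line: "tangent_bundle line = {Tline_chart}"
  by (simp add: tangent_bundle_def)

lemma points_tangent_bundle_line: "points (tangent_bundle line) = dom_chart Tline_chart"
  by (simp add: tangent_bundle_line points_def)

lemma tangent_proj_line:
  assumes "u \<in> dom_chart Tline_chart"
  shows "tangent_proj line (u, X) = (fst u, line_vec (fst (X Tline_chart)))"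
proof -
  have "frechet_derivative (\<lambda>x::real \<times> real. fst x) (at y) = fst" for y
    by (rule frechet_derivative_at[symmetric]) (auto intro: derivative_intros)
  then show ?thesis
    by (cases u)
       (use chart_at_global[OF global_Tline_chart assms] in
        \<open>simp add: tangent_proj_def tangent_map_def tangent_bundle_line coord_inv_Tline_chart
          charts_at_global[OF global_line_chart] line_vec_def Let_def cong: if_cong\<close>)
qed

section \<open>The line as a mechanical system\<close>

lemma smooth_manifold_line: "smooth_manifold line"
proof -
  \<comment> \<open>The Hausdorff property and second countability are inherited through this
    identification.\<close>
  have "manifold_topology line = (euclidean :: real topology)"
    by (rule topology_eq[THEN iffD2])
       (simp add: openin_manifold_topology_global[OF global_line_chart] image_def)
  moreover have "second_countable (euclidean :: real topology)"
  proof -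
    obtain \<B> :: "real set set" where \<B>: "countable \<B>" "topological_basis \<B>"
      using ex_countable_basis by blast
    show ?thesis
      unfolding second_countable_def
      by (intro exI[of _ \<B>] conjI \<B>(1))
         (auto simp: topological_basis_open[OF \<B>(2)] elim: topological_basisE[OF \<B>(2)])
  qed
  moreover have "\<exists>B :: real set. finite B \<and> span B = UNIV"
    using finite_Basis span_Basis by blast
  moreover have "smooth_on UNIV (\<lambda>x::real. x)"
    by (rule smooth_on_bounded_linear) (rule bounded_linear_ident)
  moreover have "inj (coord line_chart)"
    using global_line_chart by (simp add: global_chart_def bij_betw_def)
  ultimately show ?thesis
    by (simp add: smooth_manifold_def transition_global[OF global_line_chart]
        coord_range_global[OF global_line_chart] image_def)
qed

lemma mechanical_line_system:
  assumes "k \<noteq> 0"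
  shows "mechanical_system (line_system k)"
proof -
  have "bilinear (\<lambda>x y. k * x * y)"
    by (auto simp: bilinear_def intro!: linearI simp: algebra_simps)
  moreover have "v = (\<lambda>_. 0)"
    if v: "v \<in> tangent_space line p" and 0: "\<forall>w\<in>tangent_space line p. k * v line_chart * w line_chart = 0"
    for v p
  proof -
    obtain x where x: "v = line_vec x" using v by (auto simp: tangent_space_line)
    \<comment> \<open>Nondegeneracy follows by pairing \<open>v\<close> with itself.\<close>
    have "k * x * x = 0" using 0 v unfolding x by fastforce
    then show ?thesis using assms x by (auto simp: line_vec_def)
  qed
  ultimately have "pseudo_riemannian line (gmetric (line_system k))"
    by (auto simp: pseudo_riemannian_def tvec_of_global[OF global_line_chart] smooth_on_const)
  moreover have "form_coeff (tangent_bundle line) (force (line_system k)) c y = (\<lambda>_. 0)" for c y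
    by (simp add: fun_eq_iff form_coeff_def)
  then have "one_form (tangent_bundle line) (force (line_system k))"
    by (simp add: one_form_def smooth_on_const linear_zero)
  ultimately show ?thesis
    by (simp add: mechanical_system_def smooth_manifold_line horizontal_def)
qed

section \<open>The equation of motion in coordinates\<close>

lemma second_order_ode_free_field: "second_order_ode line free_field"
proof -
  \<comment> \<open>This map is \<open>free_field\<close> read in
    \<open>Tline_chart\<close>.\<close>
  have "bounded_linear (\<lambda>y::real \<times> real. (snd y, 0::real))"
    by (intro bounded_linear_Pair bounded_linear_snd bounded_linear_zero)
  then have "smooth_on UNIV (\<lambda>y::real \<times> real. (snd y, 0::real))"
    by (rule smooth_on_bounded_linear)
  then have "vector_field (tangent_bundle line) free_field"
    by (auto simp: vector_field_def tangent_bundle_line points_global[OF global_Tline_chart]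
        tangent_space_global[OF global_Tline_chart] coord_range_global[OF global_Tline_chart]
        coord_inv_Tline_chart free_field_def)
  moreover have "tangent_proj line (u, free_field u) = u" if "u \<in> dom_chart Tline_chart" for u
    using that by (auto simp: tangent_proj_line free_field_def dom_Tline_chart)
  ultimately show ?thesis
    by (simp add: second_order_ode_def points_tangent_bundle_line)
qed

lemma dot_form_line:
  assumes "u \<in> dom_chart Tline_chart"
  shows "dot_form line (liouville (line_system k)) u = k * (snd u line_chart)\<^sup>2"
  using dot_form_liouville[of "line_system k" free_field u] assms second_order_ode_free_field
  by (simp add: points_tangent_bundle_line power2_eq_square)

lemma differential_kinetic_energy_line:
  assumes "u \<in> dom_chart Tline_chart"
  shows "differential (tangent_bundle line) (kinetic_energy (line_system k)) u X =
           k * snd u line_chart * snd (X Tline_chart)"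
proof -
  have "dot_form line (liouville (line_system k)) (a, line_vec b) = k * b\<^sup>2" for a b
    by (simp add: dot_form_line dom_Tline_chart)
  then have "(\<lambda>y. kinetic_energy (line_system k) (coord_inv Tline_chart y)) = (\<lambda>y. k * (snd y)\<^sup>2 / 2)"
    by (simp add: fun_eq_iff kinetic_energy_def coord_inv_Tline_chart)
  moreover have "((\<lambda>y::real \<times> real. k * (snd y)\<^sup>2 / 2) has_derivative (\<lambda>h. k * snd y * snd h)) (at y)"
    for y
    by (auto intro!: derivative_eq_intros simp: fun_eq_iff)
  ultimately have "((\<lambda>y. kinetic_energy (line_system k) (coord_inv Tline_chart y)) has_derivative
      (\<lambda>h. k * snd (coord Tline_chart u) * snd h)) (at (coord Tline_chart u))"
    by simp
  from differential_global[OF global_Tline_chart assms this] show ?thesis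
    by (simp add: tangent_bundle_line coord_Tline_chart)
qed

text \<open>With coordinates \<open>(x, y)\<close> on the tangent bundle, the Liouville form is
  \<open>k y dx\<close>, and the right-hand side is its differential \<open>k dy \<and> dx\<close>
  evaluated on \<open>X\<close> and \<open>Y\<close>.\<close>

lemma ext_deriv_liouville_line:
  assumes "u \<in> dom_chart Tline_chart"
  shows "ext_deriv (tangent_bundle line) (liouville (line_system k)) u X Y =
           k * (snd (X Tline_chart) * fst (Y Tline_chart) - snd (Y Tline_chart) * fst (X Tline_chart))"
proof -
  have "form_coeff {Tline_chart} (liouville (line_system k)) Tline_chart y x = k * snd y * fst x" for x y
    by (simp add: form_coeff_global[OF global_Tline_chart] liouville_def tangent_proj_line
        coord_inv_Tline_chart dom_Tline_chart)
  moreover have "frechet_derivative (\<lambda>y::real \<times> real. k * snd y * a) (at y) = (\<lambda>h. k * snd h * a)" for a y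
    by (rule frechet_derivative_at[symmetric]) (auto intro!: derivative_eq_intros)
  ultimately show ?thesis
    using assms
    by (simp add: ext_deriv_def Let_def tangent_bundle_line chart_at_global[OF global_Tline_chart])
       (simp add: algebra_simps)
qed

text \<open>As the acceleration vanishes, contracting the two-form with \<open>free_field\<close>
  gives exactly minus the differential of the kinetic energy.\<close>

lemma equation_of_motion_line: "equation_of_motion (line_system k) free_field"
  by (simp add: equation_of_motion_def second_order_ode_free_field points_tangent_bundle_line
      ext_deriv_liouville_line differential_kinetic_energy_line free_field_def)

lemma relativistic_line_system: "relativistic (line_system k)"
  unfolding relativistic_def
  by (rule exI[of _ free_field])
     (simp add: equation_of_motion_line points_tangent_bundle_line differential_kinetic_energy_line
       free_field_def)

section \<open>Two free motions with different proper times\<close>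

lemma strictly_relativistic_free_motion:
  assumes "0 < T" "\<bar>k * v\<^sup>2\<bar> = 1"
  shows "strictly_relativistic_trajectory (line_system k) (free_motion v T)"
proof -
  have "continuous_map (top_of_set {0..T}) (manifold_topology {Tline_chart}) (\<lambda>t. (v * t, line_vec v))"
    by (rule continuous_map_manifold_topology_global[OF global_Tline_chart])
       (auto simp: coord_Tline_chart dom_Tline_chart intro!: continuous_intros)
  moreover have "((\<lambda>s. (v * s, v)) has_vector_derivative (v, 0)) (at t within {0..T})" for t
    by (auto intro!: derivative_eq_intros simp: has_vector_derivative_def)
  ultimately have "integral_curve (tangent_bundle line) free_field (free_motion v T)"
    using assms(1)
    by (simp add: integral_curve_def tangent_bundle_line charts_at_global[OF global_Tline_chart]
        dom_Tline_chart coord_Tline_chart free_field_def free_motion_def)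
  then show ?thesis
    using equation_of_motion_line assms(2)
    by (auto simp: strictly_relativistic_trajectory_def trajectory_def dot_form_line dom_Tline_chart)
qed

text \<open>The numbers satisfy \<open>1 * 1^2 = 4 * (1/2)^2 = 1\<close> for unit speed and
  \<open>1 * 1 = (1/2) * 2 = 1\<close> for the common endpoint.\<close>

lemma strictly_relativistic_pair_line:
  "strictly_relativistic_pair line (line_system 1) (line_system 4) 0 1
     (free_motion 1 1) (free_motion (1/2) 2)"
  by (simp add: strictly_relativistic_pair_def smooth_manifold_line mechanical_line_system
      relativistic_line_system points_def joins_def strictly_relativistic_free_motion power2_eq_square)

lemma proper_time_line_neq:
  "proper_time (line_system 1) (free_motion 1 1) \<noteq> proper_time (line_system 4) (free_motion (1/2) 2)"
  by (simp add: proper_time_strictly_relativistic strictly_relativistic_free_motion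
      smooth_manifold_line power2_eq_square)

theorem mainTheorem1:
  shows
    "(\<forall>(M :: ('a, 'e::real_normed_vector) atlas) S' S'' A B \<Gamma>' \<Gamma>''.
        strictly_relativistic_pair M S' S'' A B \<Gamma>' \<Gamma>'' \<and>
        proper_time S' \<Gamma>' \<noteq> proper_time S'' \<Gamma>'' \<longrightarrow>
        \<not> (\<exists>(S :: ('b, 'f::real_normed_vector) mech_system) \<phi>' \<phi>'' \<Gamma>.
              common_preimage M \<Gamma>' \<Gamma>'' S \<phi>' \<phi>'' \<Gamma>))
     \<and>
     (\<exists>(M :: (real, real) atlas) S' S'' A B \<Gamma>' \<Gamma>''.
        strictly_relativistic_pair M S' S'' A B \<Gamma>' \<Gamma>'' \<and>
        proper_time S' \<Gamma>' \<noteq> proper_time S'' \<Gamma>'' \<and>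
        \<not> (\<exists>(S :: ('b, 'f) mech_system) \<phi>' \<phi>'' \<Gamma>.
              common_preimage M \<Gamma>' \<Gamma>'' S \<phi>' \<phi>'' \<Gamma>))"
  \<comment> \<open>The first fact, in contrapositive form, gives (i) and also the nonexistence
    claim for the explicit pair in (ii).\<close>
  using common_preimage_imp_proper_time_eq strictly_relativistic_pair_line proper_time_line_neq
  by meson

end
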